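(* Let $G$ be a locally compact abelian group and let $\varphi\in\mathcal{H}(G)$ be a Hartman measurable function realized by $\varphi^*$ on the group compactification $(\iota_X,X)$ of $G$. Then $\mathcal{F}(\varphi)\subseteq \mathfrak{U}_{(\iota_X,X)}$. Furthermore, $\mathcal{F}(\varphi)=\mathfrak{U}_{(\iota_X,X)}$ if $\varphi^*$ is an aperiodic realization.
   Context: $G$ is a locally compact abelian (LCA) group, written additively. A group compactification of $G$ is a pair $(\iota_X,X)$ with $X$ a compact (Hausdorff) group and $\iota_X:G\to X$ a continuous homomorphism with dense image; $\mu_X$ is the normalized Haar measure on $X$, $0_X$ the unit of $X$. $(\iota_b,bG)$ denotes the Bohr compactification of $G$ (the maximal group compactification). A bounded function $f:X\to\mathbb{C}$ is Riemann integrable, $f\in R_{\mu_X}(X)$, iff its set of points of discontinuity is a $\mu_X$-null set. A bounded function $\varphi:G\to\mathbb{C}$ is Hartman measurable, $\varphi\in\mathcal{H}(G)$, iff $\varphi=\varphi_b\circ\iota_b$ for some $\varphi_b\in R_{\mu_b}(bG)$, where $\mu_b$ is Haar measure on $bG$. A function $\varphi^*$ realizes $\varphi$ on $(\iota_X,X)$ (is a realization of $\varphi$) iff $\varphi^*\in R_{\mu_X}(X)$ and $\varphi=\varphi^*\circ\iota_X$. There is a unique invariant mean $m_G$ on $\mathcal{H}(G)$, given by $m_G(\varphi)=\int_X\varphi^*\,d\mu_X$ for any realization $\varphi^*$ of $\varphi$. Translation is $\tau_g\varphi(h)=\varphi(g+h)$. For $\varphi\in\mathcal{H}(G)$ put $d_\varphi(g):=m_G(|\varphi-\tau_g\varphi|)$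 for $g\in G$, $F(\varphi,\varepsilon):=\{g\in G: d_\varphi(g)<\varepsilon\}$, and let $\mathcal{F}(\varphi)$ be the filter on $G$ generated by $\{F(\varphi,\varepsilon):\varepsilon>0\}$, i.e. the family of all $A\subseteq G$ containing some $F(\varphi,\varepsilon)$, $\varepsilon>0$. For a group compactification $(\iota_X,X)$, $\mathfrak{U}_{(\iota_X,X)}$ is the filter on $G$ generated by the sets $\iota_X^{-1}(U)$, $U$ a neighborhood of $0_X$ in $X$. A realization $\varphi^*$ on $(\iota_X,X)$ is aperiodic iff $\ker d_{\varphi^*}:=\{x\in X:\|\varphi^*-\tau_x\varphi^*\|_1=0\}=\{0_X\}$, where $\|\cdot\|_1$ is the $L^1(\mu_X)$-norm. *)

theory Defs
  imports "HOL-Analysis.Analysis" "HOL-Algebra.Group"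
begin

section \<open>Group compactifications\<close>

text \<open>The compact group is not assumed to be abelian: commutativity follows from the density of
  the image of an abelian group.\<close>

definition group_compactification ::
    "('g::topological_ab_group_add \<Rightarrow> 'x::{topological_group_add, t2_space}) \<Rightarrow> bool" where
  "group_compactification \<iota> \<longleftrightarrow>
     compact (UNIV :: 'x set) \<and>
     continuous_on UNIV \<iota> \<and>
     (\<forall>g h. \<iota> (g + h) = \<iota> g + \<iota> h) \<and>
     closure (range \<iota>) = UNIV"

text \<open>The same notion for a compact group \<open>A\<close> with topology \<open>T\<close> that lives on a subset of a type.
  It is needed because the maximality of the Bohr compactification quantifies over
  compactifications, which cannot be done at the level of types.\<close>

definition group_compactification_on ::
    "'c monoid \<Rightarrow> 'c topology \<Rightarrow> ('g::topological_ab_group_add \<Rightarrow> 'c) \<Rightarrow> bool" where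
  "group_compactification_on A T \<kappa> \<longleftrightarrow>
     group A \<and> topspace T = carrier A \<and>
     continuous_map (prod_topology T T) T (\<lambda>(x, y). x \<otimes>\<^bsub>A\<^esub> y) \<and>
     continuous_map T T (m_inv A) \<and>
     compact_space T \<and> Hausdorff_space T \<and>
     continuous_map euclidean T \<kappa> \<and>
     (\<forall>g h. \<kappa> (g + h) = \<kappa> g \<otimes>\<^bsub>A\<^esub> \<kappa> h) \<and>
     T closure_of (range \<kappa>) = carrier A"

text \<open>The Bohr compactification is the maximal group compactification: every other one is its
  image under a continuous homomorphism compatible with the maps from \<open>G\<close>. It suffices to let the
  competitors range over groups carried by subsets of \<open>'g set set\<close>, since a point \<open>x\<close> of a
  compactification \<open>\<kappa>\<close> is determined by the family of all \<open>S \<subseteq> G\<close> with \<open>x \<in> closure (\<kappa> ` S)\<close>.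
  The lemma \<open>bohr_compactification_universal\<close> below gives the property for arbitrary types.\<close>

definition bohr_compactification ::
    "('g::topological_ab_group_add \<Rightarrow> 'b::{topological_group_add, t2_space}) \<Rightarrow> bool" where
  "bohr_compactification \<iota>\<^sub>b \<longleftrightarrow>
     group_compactification \<iota>\<^sub>b \<and>
     (\<forall>(A :: 'g set set monoid) T \<kappa>. group_compactification_on A T \<kappa> \<longrightarrow>
        (\<exists>\<pi>. continuous_map euclidean T \<pi> \<and>
             (\<forall>x y. \<pi> (x + y) = \<pi> x \<otimes>\<^bsub>A\<^esub> \<pi> y) \<and>
             \<kappa> = \<pi> \<circ> \<iota>\<^sub>b))"

lemma bohr_compactification_universal:
  fixes \<iota>\<^sub>b :: "'g::topological_ab_group_add \<Rightarrow> 'b::{topological_group_add, t2_space}"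
    and \<kappa> :: "'g \<Rightarrow> 'x::{topological_group_add, t2_space}"
  assumes b: "bohr_compactification \<iota>\<^sub>b" and k: "group_compactification \<kappa>"
  shows "\<exists>\<pi>. continuous_on UNIV \<pi> \<and> (\<forall>x y. \<pi> (x + y) = \<pi> x + \<pi> y) \<and> \<kappa> = \<pi> \<circ> \<iota>\<^sub>b"
proof -
  define j :: "'x \<Rightarrow> 'g set set" where "j x = {S. x \<in> closure (\<kappa> ` S)}" for x
  define i where "i = the_inv j"
  have dense: "closure (range \<kappa>) = UNIV"
    using k by (simp add: group_compactification_def)
  have "inj j"
  proof (rule injI, rule ccontr)
    fix x y assume eq: "j x = j y" and "x \<noteq> y"
    then obtain U V where UV: "open U" "open V" "x \<in> U" "y \<in> V" "U \<inter> V = {}"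
      by (meson hausdorff)
    have im: "\<kappa> ` (\<kappa> -` U) = range \<kappa> \<inter> U" by auto
    have "x \<in> closure (range \<kappa> \<inter> U)"
      using open_Int_closure_subset[of U "range \<kappa>"] UV dense by (auto simp: Int_commute)
    then have "\<kappa> -` U \<in> j x" by (simp only: j_def mem_Collect_eq im)
    then have "\<kappa> -` U \<in> j y" by (simp only: eq)
    then have "y \<in> closure (range \<kappa> \<inter> U)" by (simp only: j_def mem_Collect_eq im)
    moreover have "V \<inter> (range \<kappa> \<inter> U) = {}" using UV by auto
    ultimately show False using UV open_Int_closure_eq_empty by blast
  qed
  then have ij [simp]: "i (j x) = x" for x
    by (simp add: i_def the_inv_f_f)
  define A :: "'g set set monoid" where
    "A = \<lparr>carrier = range j, mult = (\<lambda>p q. j (i p + i q)), one = j 0\<rparr>"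
  define T where "T = pullback_topology (range j) i (euclidean :: 'x topology)"
  have top: "topspace T = range j"
    by (auto simp: T_def topspace_pullback_topology)
  have ci: "continuous_map T euclidean i"
    using continuous_map_pullback[of euclidean euclidean id "range j" i]
    by (simp add: T_def o_def id_def)
  have cj: "continuous_map S T (\<lambda>z. j (f z))" if "continuous_map S euclidean f" for S f
    unfolding T_def using that
    by (intro continuous_map_pullback') (auto simp: o_def)
  have grp: "group A"
  proof (rule groupI)
    show "\<exists>y\<in>carrier A. y \<otimes>\<^bsub>A\<^esub> p = \<one>\<^bsub>A\<^esub>" if "p \<in> carrier A" for p
      using that by (intro bexI[of _ "j (- i p)"]) (auto simp: A_def)
  qed (auto simp: A_def add.assoc)
  have inv: "m_inv A (j x) = j (- x)" for x
    by (rule group.inv_equality[OF grp]) (auto simp: A_def)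
  have hom: "homeomorphic_map (euclidean :: 'x topology) T j"
    unfolding homeomorphic_map_maps homeomorphic_maps_def
    using cj[of euclidean id] ci by (intro exI[of _ i]) (auto simp: top)
  have "group_compactification_on A T (j \<circ> \<kappa>)"
    unfolding group_compactification_on_def
  proof (intro conjI allI)
    show "group A" by (fact grp)
    show "topspace T = carrier A" by (simp add: top A_def)
    have "continuous_map (prod_topology T T) euclidean (\<lambda>p. i (fst p) + i (snd p))"
    proof -
      have "continuous_map (prod_topology T T) euclidean (i \<circ> fst)"
           "continuous_map (prod_topology T T) euclidean (i \<circ> snd)"
        using ci by (auto intro: continuous_map_compose[OF continuous_map_fst]
            continuous_map_compose[OF continuous_map_snd])
      then have "continuous_map (prod_topology T T) (euclidean :: ('x \<times> 'x) topology)
          (\<lambda>p. (i (fst p), i (snd p)))"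
        unfolding prod_topology_euclidean[symmetric] continuous_map_paired by (simp add: o_def)
      moreover have "continuous_map euclidean euclidean (\<lambda>p :: 'x \<times> 'x. fst p + snd p)"
        by (auto intro!: continuous_intros)
      ultimately show ?thesis
        using continuous_map_compose[of "prod_topology T T" euclidean "\<lambda>p. (i (fst p), i (snd p))"
            euclidean "\<lambda>p. fst p + snd p"] by (simp add: o_def)
    qed
    from cj[OF this] show "continuous_map (prod_topology T T) T (\<lambda>(x, y). x \<otimes>\<^bsub>A\<^esub> y)"
      by (simp add: A_def case_prod_unfold)
    have "continuous_map euclidean euclidean (uminus :: 'x \<Rightarrow> 'x)"
      by (auto intro!: continuous_intros)
    from cj[OF continuous_map_compose[OF ci this]]
    have "continuous_map T T (\<lambda>p. j (- i p))" by (simp add: o_def)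
    then show "continuous_map T T (m_inv A)"
      by (rule continuous_map_eq) (auto simp: top inv)
    have "compact_space (euclidean :: 'x topology)"
      using k by (simp add: group_compactification_def compact_space_def)
    then show "compact_space T"
      using hom homeomorphic_compact_space homeomorphic_map_imp_homeomorphic_space by blast
    have "Hausdorff_space (euclidean :: 'x topology)"
      by (auto simp: Hausdorff_space_def disjnt_def) (metis hausdorff)
    then show "Hausdorff_space T"
      using hom homeomorphic_Hausdorff_space homeomorphic_map_imp_homeomorphic_space by blast
    show "continuous_map euclidean T (j \<circ> \<kappa>)"
      using k cj[of euclidean \<kappa>] by (simp add: group_compactification_def o_def)
    show "(j \<circ> \<kappa>) (g + h) = (j \<circ> \<kappa>) g \<otimes>\<^bsub>A\<^esub> (j \<circ> \<kappa>) h" for g h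
      using k by (simp add: group_compactification_def A_def)
    have "T closure_of (j ` range \<kappa>) = j ` (euclidean closure_of range \<kappa>)"
      using homeomorphic_map_closure_of[OF hom, of "range \<kappa>"] by simp
    then show "T closure_of range (j \<circ> \<kappa>) = carrier A"
      using dense by (simp add: image_comp A_def)
  qed
  with b obtain p where p: "continuous_map euclidean T p"
      "\<And>x y. p (x + y) = p x \<otimes>\<^bsub>A\<^esub> p y" "j \<circ> \<kappa> = p \<circ> \<iota>\<^sub>b"
    unfolding bohr_compactification_def by blast
  show ?thesis
  proof (intro exI[of _ "i \<circ> p"] conjI allI)
    show "continuous_on UNIV (i \<circ> p)"
      using continuous_map_compose[OF p(1) ci] by simp
    show "(i \<circ> p) (x + y) = (i \<circ> p) x + (i \<circ> p) y" for x y
      by (simp add: p(2)) (simp add: A_def)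
    show "\<kappa> = i \<circ> p \<circ> \<iota>\<^sub>b"
      by (metis (no_types, lifting) comp_assoc comp_apply ext ij p(3))
  qed
qed


section \<open>Haar measure and Riemann integrability\<close>

text \<open>Normalized Haar measure as a measure on the Borel sets. Inner regularity on all Borel sets
  is the full regularity condition for a finite measure on a compact Hausdorff space; outer
  regularity follows by taking complements.\<close>

definition normalized_haar_measure ::
    "'x::{topological_group_add, t2_space} measure \<Rightarrow> bool" where
  "normalized_haar_measure \<mu> \<longleftrightarrow>
     sets \<mu> = sets borel \<and>
     emeasure \<mu> (space \<mu>) = 1 \<and>
     (\<forall>x. \<forall>B\<in>sets borel. emeasure \<mu> ((+) x ` B) = emeasure \<mu> B) \<and>
     (\<forall>B\<in>sets borel. emeasure \<mu> B = (SUP K\<in>{K. compact K \<and> K \<subseteq> B}. emeasure \<mu> K))"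

text \<open>The set of discontinuities of a complex function is always Borel (an \<open>F\<^sub>\<sigma>\<close> set), so
  \<open>null_sets \<mu>\<close> imposes no extra measurability condition.\<close>

definition riemann_integrable :: "'x::t2_space measure \<Rightarrow> ('x \<Rightarrow> complex) \<Rightarrow> bool" where
  "riemann_integrable \<mu> f \<longleftrightarrow> bounded (range f) \<and> {x. \<not> isCont f x} \<in> null_sets \<mu>"

definition realizes ::
    "'x::t2_space measure \<Rightarrow> ('g \<Rightarrow> 'x) \<Rightarrow> ('x \<Rightarrow> complex) \<Rightarrow> ('g \<Rightarrow> complex) \<Rightarrow> bool" where
  "realizes \<mu> \<iota> f \<phi> \<longleftrightarrow> riemann_integrable \<mu> f \<and> \<phi> = f \<circ> \<iota>"


section \<open>Hartman measurable functions\<close>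

text \<open>In the following, \<open>\<iota>\<^sub>b\<close> and \<open>\<mu>\<^sub>b\<close> stand for the Bohr compactification of the group and for the
  Haar measure on it.\<close>

definition hartman_measurable ::
    "'b::t2_space measure \<Rightarrow> ('g \<Rightarrow> 'b) \<Rightarrow> ('g \<Rightarrow> complex) set" where
  "hartman_measurable \<mu>\<^sub>b \<iota>\<^sub>b = {\<phi>. bounded (range \<phi>) \<and> (\<exists>\<phi>\<^sub>b. realizes \<mu>\<^sub>b \<iota>\<^sub>b \<phi>\<^sub>b \<phi>)}"

text \<open>The invariant mean on Hartman measurable functions: the common value of the integrals of all
  realizations on the Bohr compactification. Riemann integrable functions need not be Borel
  measurable, so the integrals are taken with respect to the completed Haar measure.\<close>

definition hartman_mean ::
    "'b::t2_space measure \<Rightarrow> ('g \<Rightarrow> 'b) \<Rightarrow> ('g \<Rightarrow> complex) \<Rightarrow> complex" where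
  "hartman_mean \<mu>\<^sub>b \<iota>\<^sub>b \<phi> =
     (THE c. \<forall>\<phi>\<^sub>b. realizes \<mu>\<^sub>b \<iota>\<^sub>b \<phi>\<^sub>b \<phi> \<longrightarrow> (\<integral>x. \<phi>\<^sub>b x \<partial>completion \<mu>\<^sub>b) = c)"

definition translate :: "'a::plus \<Rightarrow> ('a \<Rightarrow> 'c) \<Rightarrow> 'a \<Rightarrow> 'c" where
  "translate g \<phi> = (\<lambda>h. \<phi> (g + h))"

definition hartman_dist ::
    "'b::t2_space measure \<Rightarrow> ('g::plus \<Rightarrow> 'b) \<Rightarrow> ('g \<Rightarrow> complex) \<Rightarrow> 'g \<Rightarrow> real" where
  "hartman_dist \<mu>\<^sub>b \<iota>\<^sub>b \<phi> g =
     Re (hartman_mean \<mu>\<^sub>b \<iota>\<^sub>b (\<lambda>h. complex_of_real (cmod (\<phi> h - translate g \<phi> h))))"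

definition hartman_nbhd ::
    "'b::t2_space measure \<Rightarrow> ('g::plus \<Rightarrow> 'b) \<Rightarrow> ('g \<Rightarrow> complex) \<Rightarrow> real \<Rightarrow> 'g set" where
  "hartman_nbhd \<mu>\<^sub>b \<iota>\<^sub>b \<phi> \<epsilon> = {g. hartman_dist \<mu>\<^sub>b \<iota>\<^sub>b \<phi> g < \<epsilon>}"

text \<open>Both filters are taken as families of subsets of the group, so that inclusion of filters is
  inclusion of families. (On the type \<open>'a filter\<close> the order is reversed.)\<close>

definition hartman_filter ::
    "'b::t2_space measure \<Rightarrow> ('g::plus \<Rightarrow> 'b) \<Rightarrow> ('g \<Rightarrow> complex) \<Rightarrow> 'g set set" where
  "hartman_filter \<mu>\<^sub>b \<iota>\<^sub>b \<phi> = {A. \<exists>\<epsilon>>0. hartman_nbhd \<mu>\<^sub>b \<iota>\<^sub>b \<phi> \<epsilon> \<subseteq> A}"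

definition compactification_filter ::
    "('g \<Rightarrow> 'x::{topological_space, zero}) \<Rightarrow> 'g set set" where
  "compactification_filter \<iota> = {A. \<exists>U. open U \<and> 0 \<in> U \<and> \<iota> -` U \<subseteq> A}"

lemma hartman_filter_eventually:
  "A \<in> hartman_filter \<mu>\<^sub>b \<iota>\<^sub>b \<phi> \<longleftrightarrow>
     eventually (\<lambda>g. g \<in> A) (INF \<epsilon>\<in>{0<..}. principal (hartman_nbhd \<mu>\<^sub>b \<iota>\<^sub>b \<phi> \<epsilon>))"
proof (subst eventually_INF_base)
  fix a b :: real assume "a \<in> {0<..}" "b \<in> {0<..}"
  then show "\<exists>x\<in>{0<..}. principal (hartman_nbhd \<mu>\<^sub>b \<iota>\<^sub>b \<phi> x)
      \<le> inf (principal (hartman_nbhd \<mu>\<^sub>b \<iota>\<^sub>b \<phi> a)) (principal (hartman_nbhd \<mu>\<^sub>b \<iota>\<^sub>b \<phi> b))"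
    by (intro bexI[of _ "min a b"]) (auto simp: hartman_nbhd_def)
qed (auto simp: hartman_filter_def eventually_principal)

lemma compactification_filter_eventually:
  "A \<in> compactification_filter \<iota> \<longleftrightarrow> eventually (\<lambda>g. g \<in> A) (filtercomap \<iota> (nhds 0))"
proof -
  have "\<iota> -` U \<subseteq> A \<longleftrightarrow> (\<forall>g. \<iota> g \<in> U \<longrightarrow> g \<in> A)" for U by auto
  then show ?thesis
    by (auto simp: compactification_filter_def eventually_filtercomap_nhds)
qed


section \<open>Aperiodicity\<close>

definition l1_dist ::
    "'x::{t2_space, plus} measure \<Rightarrow> ('x \<Rightarrow> complex) \<Rightarrow> 'x \<Rightarrow> real" where
  "l1_dist \<mu> f x = (\<integral>y. cmod (f y - translate x f y) \<partial>completion \<mu>)"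

definition aperiodic ::
    "'x::{t2_space, plus, zero} measure \<Rightarrow> ('x \<Rightarrow> complex) \<Rightarrow> bool" where
  "aperiodic \<mu> f \<longleftrightarrow> {x. l1_dist \<mu> f x = 0} = {0}"

end

theory Submission
  imports Defs
begin

text \<open>The integral of a Riemann integrable function over a group compactification is determined by
  its restriction to \<open>G\<close>: finitely many translates of the function have convex combinations that
  approximate the integral uniformly on \<open>G\<close>, and two such averages on different compactifications
  can be applied one after the other. Hence \<open>d\<^sub>\<phi> g = \<parallel>\<phi>\<^sup>* - \<tau>\<^sub>x \<phi>\<^sup>*\<parallel>\<^sub>1\<close> at \<open>x = \<iota>\<^sub>X g\<close>. The right-hand side is
  continuous in \<open>x\<close> and vanishes at \<open>0\<close>, which gives the inclusion; if it vanishes only at \<open>0\<close>,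
  compactness bounds it away from zero off any neighborhood of \<open>0\<close>.\<close>

section \<open>Continuity points\<close>

lemma isCont_iff_open_dist:
  fixes f :: "'x::t2_space \<Rightarrow> 'a::metric_space"
  shows "isCont f x \<longleftrightarrow> (\<forall>e>0. \<exists>U. open U \<and> x \<in> U \<and> (\<forall>y\<in>U. dist (f y) (f x) < e))"
  by (simp only: isCont_def tendsto_at_iff_tendsto_nhds) (simp only: tendsto_iff eventually_nhds)

text \<open>The continuity points form a G-delta set: \<open>A n\<close> is the open set of points
  having a neighborhood on which \<open>f\<close> varies by less than \<open>1 / (n + 1)\<close>,
  and \<open>f\<close> is continuous exactly on the intersection of all \<open>A n\<close>.\<close>

lemma borel_not_isCont:
  fixes f :: "'x::t2_space \<Rightarrow> 'a::metric_space"
  shows "{x. \<not> isCont f x} \<in> sets borel"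
proof -
  define A where "A n = \<Union>{U. open U \<and> (\<forall>y\<in>U. \<forall>z\<in>U. dist (f y) (f z) < inverse (real (Suc n)))}" for n
  have "isCont f x \<longleftrightarrow> (\<forall>n. x \<in> A n)" for x
  proof
    assume x: "isCont f x"
    show "\<forall>n. x \<in> A n"
    proof
      fix n
      have "inverse (real (Suc n)) / 2 > 0" by simp
      with x obtain U where U: "open U" "x \<in> U" "\<And>y. y \<in> U \<Longrightarrow> dist (f y) (f x) < inverse (real (Suc n)) / 2"
        unfolding isCont_iff_open_dist by meson
      then have "dist (f y) (f z) < inverse (real (Suc n))" if "y \<in> U" "z \<in> U" for y z
        using that by (blast intro: dist_triangle_half_l)
      with U show "x \<in> A n" by (auto simp: A_def)
    qed
  next
    assume x: "\<forall>n. x \<in> A n"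
    show "isCont f x"
      unfolding isCont_iff_open_dist
    proof (intro allI impI)
      fix e :: real assume "e > 0"
      then obtain n where n: "inverse (real (Suc n)) < e" using reals_Archimedean by blast
      from x have "x \<in> A n" by simp
      then obtain U where "open U" "x \<in> U" "\<forall>y\<in>U. \<forall>z\<in>U. dist (f y) (f z) < inverse (real (Suc n))"
        by (auto simp: A_def)
      with n show "\<exists>U. open U \<and> x \<in> U \<and> (\<forall>y\<in>U. dist (f y) (f x) < e)"
        by (intro exI[of _ U]) (auto intro: less_trans)
    qed
  qed
  then have "{x. \<not> isCont f x} = - (\<Inter>n. A n)" by auto
  moreover have "open (A n)" for n by (auto simp: A_def)
  ultimately show ?thesis by auto
qed

text \<open>Continuity of addition at \<open>(0, x)\<close>. It turns continuity of a function at
  \<open>x\<close> into control of small left translations of all points near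
  \<open>x\<close>.\<close>

lemma open_add_nbhds:
  fixes x :: "'x::topological_monoid_add"
  assumes "open S" "x \<in> S"
  obtains V W where "open V" "0 \<in> V" "open W" "x \<in> W" "\<And>v w. v \<in> V \<Longrightarrow> w \<in> W \<Longrightarrow> v + w \<in> S"
proof -
  have "open ((\<lambda>p. fst p + snd p) -` S)"
    using assms by (intro open_vimage) (auto intro!: continuous_intros)
  then obtain V W where "open V" "open W" "(0, x) \<in> V \<times> W" "V \<times> W \<subseteq> (\<lambda>p. fst p + snd p) -` S"
    by (rule open_prod_elim) (use assms in auto)
  then show thesis by (intro that[of V W]) auto
qed

section \<open>Haar measure and Riemann integrable functions\<close>

locale haar_measure =
  fixes \<mu> :: "'x::{topological_group_add, t2_space} measure"
  assumes haar: "normalized_haar_measure \<mu>"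
begin

lemma sets_haar [simp, measurable_cong]: "sets \<mu> = sets borel"
  using haar by (simp add: normalized_haar_measure_def)

lemma space_haar [simp]: "space \<mu> = UNIV"
  using sets_eq_imp_space_eq[OF sets_haar] by simp

lemma emeasure_haar_UNIV [simp]: "emeasure \<mu> UNIV = 1"
  using haar by (simp add: normalized_haar_measure_def)

sublocale completion: finite_measure "completion \<mu>"
  by (rule finite_measureI) (simp add: emeasure_completion)

lemma measure_haar_UNIV [simp]: "measure \<mu> UNIV = 1"
  by (simp add: measure_def)

section \<open>Translation invariance of the completed Haar measure\<close>

lemma measurable_add_left: "(+) x \<in> borel_measurable \<mu>"
proof -
  have "(+) x \<in> borel_measurable (borel :: 'x measure)"
    by (intro borel_measurable_continuous_onI continuous_intros)
  then show ?thesis by simp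
qed

lemma distr_haar_add: "distr \<mu> \<mu> ((+) x) = \<mu>"
proof (rule measure_eqI)
  fix B assume "B \<in> sets (distr \<mu> \<mu> ((+) x))"
  then have B: "B \<in> sets borel" by simp
  have "(+) x -` B = (+) (- x) ` B"
    by (force simp: image_iff)
  then show "emeasure (distr \<mu> \<mu> ((+) x)) B = emeasure \<mu> B"
    using B haar measurable_add_left
    by (subst emeasure_distr) (auto simp: normalized_haar_measure_def cong: measurable_cong_sets)
qed simp

text \<open>Measurability between the completions requires preimages of null sets to be null, which
  is where the invariance \<open>d\<close> of the measure enters.\<close>

lemma measurable_completion_add: "(+) x \<in> completion \<mu> \<rightarrow>\<^sub>M completion \<mu>"
  and distr_completion_add: "distr (completion \<mu>) (completion \<mu>) ((+) x) = completion \<mu>"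
proof -
  have m: "(+) x \<in> \<mu> \<rightarrow>\<^sub>M \<mu>"
    using measurable_add_left by (simp cong: measurable_cong_sets)
  have d: "distr (completion \<mu>) \<mu> ((+) x) = \<mu>"
    by (simp add: distr_completion[OF m] distr_haar_add)
  show "(+) x \<in> completion \<mu> \<rightarrow>\<^sub>M completion \<mu>"
    by (rule completion.measurable_completion2) (auto simp: d measurable_completion m)
  show "distr (completion \<mu>) (completion \<mu>) ((+) x) = completion \<mu>"
    using completion.completion_distr_eq[OF measurable_completion[OF m]] by (simp add: d)
qed

lemma AE_add:
  assumes "AE y in \<mu>. P y"
  shows "AE y in \<mu>. P (x + y)"
proof -
  have "AE y in distr (completion \<mu>) (completion \<mu>) ((+) x). P y"
    unfolding distr_completion_add using assms by (rule AE_completion)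
  then have "AE y in completion \<mu>. P (x + y)"
    using AE_distrD[OF measurable_completion_add] by blast
  then show ?thesis by (simp add: AE_completion_iff)
qed

lemma integrable_completion_add:
  fixes f :: "'x \<Rightarrow> 'a::{banach, second_countable_topology}"
  assumes "integrable (completion \<mu>) f"
  shows "integrable (completion \<mu>) (\<lambda>y. f (x + y))"
  using integrable_distr[OF measurable_completion_add, of x f] assms by (simp add: distr_completion_add)

lemma integral_completion_add:
  fixes f :: "'x \<Rightarrow> 'a::{banach, second_countable_topology}"
  assumes "integrable (completion \<mu>) f"
  shows "(\<integral>y. f (x + y) \<partial>completion \<mu>) = (\<integral>y. f y \<partial>completion \<mu>)"
  using integral_distr[OF measurable_completion_add, of f x] assms
  by (simp add: distr_completion_add borel_measurable_integrable)

section \<open>Functions continuous almost everywhere\<close>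

text \<open>The preimage of an open set differs from its interior only in discontinuity points,
  hence by a subset of a null set.\<close>

lemma AE_isCont_borel_measurable:
  fixes f :: "'x \<Rightarrow> 'a::metric_space"
  assumes "AE x in \<mu>. isCont f x"
  shows "f \<in> borel_measurable (completion \<mu>)"
proof (rule borel_measurableI)
  fix S :: "'a set" assume S: "open S"
  from assms obtain N where N: "N \<in> null_sets \<mu>" "{x. \<not> isCont f x} \<subseteq> N"
    by (auto simp: eventually_ae_filter)
  have "f -` S - interior (f -` S) \<subseteq> N"
  proof
    fix x assume x: "x \<in> f -` S - interior (f -` S)"
    have "\<not> isCont f x"
    proof
      assume "isCont f x"
      then have "(f \<longlongrightarrow> f x) (nhds x)" by (simp only: isCont_def tendsto_at_iff_tendsto_nhds)
      then have "\<forall>\<^sub>F y in nhds x. f y \<in> S" using S x by (intro topological_tendstoD) auto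
      with x show False by (auto simp: eventually_nhds interior_def)
    qed
    with N show "x \<in> N" by auto
  qed
  moreover have "f -` S = interior (f -` S) \<union> (f -` S - interior (f -` S))"
    using interior_subset by blast
  moreover have "interior (f -` S) \<in> sets \<mu>" by simp
  ultimately have "f -` S \<in> sets (completion \<mu>)"
    using sets_completionI[OF _ _ N(1)] by blast
  then show "f -` S \<inter> space (completion \<mu>) \<in> sets (completion \<mu>)" by simp
qed

lemma AE_isCont_integrable:
  fixes f :: "'x \<Rightarrow> 'a::{banach, second_countable_topology}"
  assumes "bounded (range f)" "AE x in \<mu>. isCont f x"
  shows "integrable (completion \<mu>) f"
proof -
  from assms(1) obtain B where "norm (f x) \<le> B" for x by (auto simp: bounded_iff)
  then show ?thesis
    using AE_isCont_borel_measurable[OF assms(2)]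
    by (intro completion.integrable_const_bound[of _ B]) auto
qed

text \<open>Inner regularity is applied to the complement of a Borel null set that contains all
  exceptional points; this complement has measure 1.\<close>

lemma AE_compact_subset:
  assumes "AE x in \<mu>. P x" "e > 0"
  obtains K where "compact K" "\<And>x. x \<in> K \<Longrightarrow> P x" "measure (completion \<mu>) (- K) < e"
proof -
  from assms obtain N where N: "N \<in> null_sets \<mu>" "{x. \<not> P x} \<subseteq> N"
    by (auto simp: eventually_ae_filter)
  then have [measurable]: "N \<in> sets borel" by auto
  have "emeasure \<mu> (- N) = 1"
    using emeasure_Diff_null_set[OF N(1), of UNIV] by (simp add: Compl_eq_Diff_UNIV)
  \<comment> \<open>For \<open>e > 1\<close> the value \<open>ennreal (1 - e)\<close> is 0, so large
    \<open>e\<close> is covered as well.\<close>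
  moreover have "ennreal (1 - e) < 1" using assms(2) by (simp add: ennreal_less_one_iff)
  moreover have "emeasure \<mu> (- N) = (SUP K\<in>{K. compact K \<and> K \<subseteq> - N}. emeasure \<mu> K)"
    using haar unfolding normalized_haar_measure_def by (metis \<open>N \<in> sets borel\<close> borel_comp)
  ultimately obtain K where K: "compact K" "K \<subseteq> - N" "ennreal (1 - e) < emeasure \<mu> K"
    by (metis (mono_tags, lifting) less_SUP_iff mem_Collect_eq)
  have Kb: "K \<in> sets borel" using K(1) by (intro borel_closed compact_imp_closed)
  have "emeasure \<mu> K = emeasure (completion \<mu>) K" using Kb by simp
  then have "1 - e < measure (completion \<mu>) K"
    using K(3) unfolding completion.emeasure_eq_measure by (metis ennreal_less_iff ennreal_lessI linorder_not_less ennreal_leI)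
  moreover have "measure (completion \<mu>) (- K) = 1 - measure (completion \<mu>) K"
    using completion.finite_measure_compl[of K] Kb by (simp add: Compl_eq_Diff_UNIV)
  ultimately show thesis using K N by (intro that[of K]) auto
qed

text \<open>Inner regularity produces a compact set of continuity points with almost full measure; there
  \<open>f\<close> oscillates little under small translations, and off it \<open>f\<close> is bounded.\<close>

lemma integrable_oscillation_bound:
  fixes f :: "'x \<Rightarrow> 'a::real_normed_vector"
  assumes "bounded (range f)" "AE x in \<mu>. isCont f x" "e > 0"
  obtains U r where "open U" "0 \<in> U" "integrable (completion \<mu>) r"
    "(\<integral>y. r y \<partial>completion \<mu>) < e" "\<And>u y. u \<in> U \<Longrightarrow> norm (f (u + y) - f y) \<le> r y"
proof -
  obtain B where B: "B > 0" "\<And>x. norm (f x) \<le> B"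
    using assms(1) by (auto simp: bounded_pos)
  \<comment> \<open>Chosen so that the final estimate \<open>d + 2 * B * d\<close> stays strictly
    below \<open>e\<close>.\<close>
  define d where "d = e / (2 + 2 * B)"
  have d: "d > 0" "d * (1 + 2 * B) < e"
    using assms(3) B(1) by (auto simp: d_def field_simps)
  obtain K where K: "compact K" "\<And>x. x \<in> K \<Longrightarrow> isCont f x" "measure (completion \<mu>) (- K) < d"
    using AE_compact_subset[OF assms(2) d(1)] by blast
  \<comment> \<open>\<open>V\<close> restricts the translation and \<open>W\<close> the translated
    point. Half of \<open>d\<close> suffices, since \<open>u + y\<close> and \<open>y\<close> are
    both compared with \<open>x\<close>, the latter as the translate of \<open>y\<close> by
    0.\<close>
  define Q where "Q x V W \<longleftrightarrow> open V \<and> 0 \<in> V \<and> open W \<and> x \<in> W \<and>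
      (\<forall>v\<in>V. \<forall>w\<in>W. dist (f (v + w)) (f x) < d / 2)" for x V W
  have "\<exists>V W. Q x V W" if xK: "x \<in> K" for x
  proof -
    obtain S where S: "open S" "x \<in> S" "\<forall>y\<in>S. dist (f y) (f x) < d / 2"
      using K(2)[OF xK] d(1) unfolding isCont_iff_open_dist by (meson half_gt_zero)
    obtain V W where "open V" "0 \<in> V" "open W" "x \<in> W" "\<And>v w. v \<in> V \<Longrightarrow> w \<in> W \<Longrightarrow> v + w \<in> S"
      using open_add_nbhds[OF S(1,2)] by blast
    with S(3) have "Q x V W" by (simp add: Q_def)
    then show ?thesis by blast
  qed
  then obtain V W where Q: "\<And>x. x \<in> K \<Longrightarrow> Q x (V x) (W x)" by metis
  have VW: "open (V x)" "0 \<in> V x" "open (W x)" "x \<in> W x"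
    "\<And>v w. v \<in> V x \<Longrightarrow> w \<in> W x \<Longrightarrow> dist (f (v + w)) (f x) < d / 2" if "x \<in> K" for x
    using Q[OF that] by (auto simp: Q_def)
  obtain C where C: "C \<subseteq> K" "finite C" "K \<subseteq> (\<Union>x\<in>C. W x)"
    by (rule compactE_image[OF K(1), of K W]) (use VW in auto)
  \<comment> \<open>A finite intersection is still a neighborhood of 0, and it serves all points of
    \<open>K\<close> at once.\<close>
  define U where "U = (\<Inter>x\<in>C. V x)"
  \<comment> \<open>The crude bound \<open>2 * B\<close> is charged only off \<open>K\<close>, on a
    set of measure below \<open>d\<close>. As \<open>r\<close> does not depend on \<open>u\<close>,
    it can later be used with a translation that varies with \<open>y\<close>.\<close>
  define r where "r y = d + 2 * B * indicator (- K) y" for y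
  have Kb: "- K \<in> sets borel" using K(1) by (intro borel_comp borel_closed compact_imp_closed)
  show thesis
  proof
    show "open U" using C VW by (auto simp: U_def)
    show "0 \<in> U" using C VW by (auto simp: U_def)
    show "integrable (completion \<mu>) r"
      using Kb completion.emeasure_finite[of "- K"] unfolding r_def
      by (intro Bochner_Integration.integrable_add integrable_mult_right integrable_real_indicator)
        (auto simp: top.not_eq_extremum)
    have "(\<integral>y. r y \<partial>completion \<mu>) = d + 2 * B * measure (completion \<mu>) (- K)"
      using Kb completion.emeasure_finite[of "- K"] unfolding r_def
      by (subst Bochner_Integration.integral_add)
        (auto simp: top.not_eq_extremum)
    also have "\<dots> < d + 2 * B * d"
      using K(3) B(1) by simp
    also have "\<dots> < e"
      using d(2) by (simp add: algebra_simps)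
    finally show "(\<integral>y. r y \<partial>completion \<mu>) < e" .
    show "norm (f (u + y) - f y) \<le> r y" if u: "u \<in> U" for u y
    proof (cases "y \<in> K")
      case True
      with C obtain x where x: "x \<in> C" "y \<in> W x" by blast
      have xK: "x \<in> K" using x C by blast
      have "u \<in> V x" using x u by (simp add: U_def)
      then have "dist (f (u + y)) (f x) < d / 2" using VW(5)[OF xK] x by blast
      moreover have "dist (f y) (f x) < d / 2" using VW(5)[OF xK VW(2)[OF xK] x(2)] by simp
      ultimately have "dist (f (u + y)) (f y) < d" by (rule dist_triangle_half_l)
      with True show ?thesis by (simp add: r_def dist_norm)
    next
      case False
      have "norm (f (u + y) - f y) \<le> B + B"
        by (rule norm_triangle_le_diff) (intro add_mono B)
      with False d(1) show ?thesis by (simp add: r_def)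
    qed
  qed
qed

section \<open>Closure properties of Riemann integrable functions\<close>

lemma riemann_integrable_iff:
  "riemann_integrable \<mu> f \<longleftrightarrow> bounded (range f) \<and> (AE x in \<mu>. isCont f x)"
  using borel_not_isCont[of f] by (auto simp: riemann_integrable_def AE_iff_null)

lemma riemann_integrable_integrable:
  "riemann_integrable \<mu> f \<Longrightarrow> integrable (completion \<mu>) f"
  by (simp add: riemann_integrable_iff AE_isCont_integrable)

lemma riemann_integrable_translate:
  assumes "riemann_integrable \<mu> f"
  shows "riemann_integrable \<mu> (translate x f)"
  unfolding riemann_integrable_iff
proof
  show "bounded (range (translate x f))"
    using assms by (auto simp: riemann_integrable_iff translate_def intro: bounded_subset)
  have "isCont (translate x f) y" if "isCont f (x + y)" for y
    unfolding translate_def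
    by (rule isCont_o2[where f = "(+) x" and g = f]) (auto intro: continuous_intros that)
  then show "AE y in \<mu>. isCont (translate x f) y"
    using AE_add[of "isCont f" x] assms by (auto simp: riemann_integrable_iff elim: eventually_mono)
qed

lemma riemann_integrable_cmod_diff:
  assumes "riemann_integrable \<mu> f" "riemann_integrable \<mu> g"
  shows "riemann_integrable \<mu> (\<lambda>x. complex_of_real (cmod (f x - g x)))"
  unfolding riemann_integrable_iff
proof
  obtain A B where "cmod (f x) \<le> A" "cmod (g x) \<le> B" for x
    using assms by (auto simp: riemann_integrable_def bounded_iff)
  then have "cmod (f x - g x) \<le> A + B" for x
    by (intro norm_triangle_le_diff add_mono)
  then show "bounded (range (\<lambda>x. complex_of_real (cmod (f x - g x))))"
    by (auto simp: bounded_iff)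
  show "AE x in \<mu>. isCont (\<lambda>x. complex_of_real (cmod (f x - g x))) x"
    using assms[unfolded riemann_integrable_iff, THEN conjunct2]
    by eventually_elim (intro continuous_intros)
qed

section \<open>The distance between a function and its translates\<close>

lemma integrable_l1_dist:
  assumes "riemann_integrable \<mu> f"
  shows "integrable (completion \<mu>) (\<lambda>y. cmod (f y - translate x f y))"
  using assms by (intro integrable_norm Bochner_Integration.integrable_diff
      riemann_integrable_integrable riemann_integrable_translate)

text \<open>Pass from \<open>f z\<close> to \<open>f (x + z)\<close> through
  \<open>f (y + z)\<close>. The second leg is the difference for \<open>x - y\<close> read at
  \<open>y + z\<close>, and invariance of the integral removes the shift by
  \<open>y\<close>.\<close>

lemma l1_dist_triangle:
  assumes "riemann_integrable \<mu> f"
  shows "l1_dist \<mu> f x \<le> l1_dist \<mu> f y + l1_dist \<mu> f (x - y)"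
proof -
  let ?d = "\<lambda>x z. cmod (f z - translate x f z)"
  have *: "?d (x - y) (y + z) = cmod (f (y + z) - f (x + z))" for z
    by (simp add: translate_def flip: add.assoc)
  have i: "integrable (completion \<mu>) (\<lambda>z. ?d (x - y) (y + z))"
    using integrable_completion_add[OF integrable_l1_dist[OF assms, of "x - y"], of y] .
  have "(\<integral>z. ?d x z \<partial>completion \<mu>) \<le> (\<integral>z. ?d y z + ?d (x - y) (y + z) \<partial>completion \<mu>)"
  proof (rule integral_mono)
    show "?d x z \<le> ?d y z + ?d (x - y) (y + z)" for z
      using norm_triangle_ineq[of "f z - f (y + z)" "f (y + z) - f (x + z)"]
      unfolding * by (simp add: translate_def)
  qed (intro Bochner_Integration.integrable_add integrable_l1_dist assms i)+
  also have "\<dots> = (\<integral>z. ?d y z \<partial>completion \<mu>) + (\<integral>z. ?d (x - y) z \<partial>completion \<mu>)"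
    using integral_completion_add[OF integrable_l1_dist[OF assms, of "x - y"], of y]
    by (subst Bochner_Integration.integral_add) (simp_all add: i integrable_l1_dist assms)
  finally show ?thesis by (simp add: l1_dist_def)
qed

lemma l1_dist_less_near_zero:
  assumes "riemann_integrable \<mu> f" "e > 0"
  obtains U where "open U" "0 \<in> U" "\<And>u. u \<in> U \<Longrightarrow> l1_dist \<mu> f u < e"
proof -
  obtain U r where U: "open U" "0 \<in> U" "integrable (completion \<mu>) r"
    "(\<integral>y. r y \<partial>completion \<mu>) < e" "\<And>u y. u \<in> U \<Longrightarrow> norm (f (u + y) - f y) \<le> r y"
    using assms integrable_oscillation_bound unfolding riemann_integrable_iff by metis
  have "l1_dist \<mu> f u \<le> (\<integral>y. r y \<partial>completion \<mu>)" if "u \<in> U" for u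
    unfolding l1_dist_def
    using U(5)[OF that] by (intro integral_mono integrable_l1_dist assms U)
      (simp add: translate_def norm_minus_commute)
  with U show thesis by (intro that[of U]) force+
qed

text \<open>The triangle inequality, used in both directions, reduces continuity at \<open>x\<close>
  to smallness near 0; hence \<open>y - x\<close> and \<open>x - y\<close> are both kept in
  \<open>U\<close>.\<close>

lemma continuous_on_l1_dist:
  assumes "riemann_integrable \<mu> f"
  shows "continuous_on UNIV (l1_dist \<mu> f)"
proof -
  have "isCont (l1_dist \<mu> f) x" for x
    unfolding isCont_iff_open_dist
  proof (intro allI impI)
    fix e :: real assume "e > 0"
    then obtain U where U: "open U" "0 \<in> U" "\<And>u. u \<in> U \<Longrightarrow> l1_dist \<mu> f u < e"
      using l1_dist_less_near_zero[OF assms] by blast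
    show "\<exists>S. open S \<and> x \<in> S \<and> (\<forall>y\<in>S. dist (l1_dist \<mu> f y) (l1_dist \<mu> f x) < e)"
    proof (intro exI conjI ballI)
      show "open ((\<lambda>y. y - x) -` U \<inter> (\<lambda>y. x - y) -` U)"
        using U by (intro open_Int open_vimage continuous_intros)
      show "x \<in> (\<lambda>y. y - x) -` U \<inter> (\<lambda>y. x - y) -` U" using U by simp
      fix y assume "y \<in> (\<lambda>y. y - x) -` U \<inter> (\<lambda>y. x - y) -` U"
      then have "l1_dist \<mu> f (y - x) < e" "l1_dist \<mu> f (x - y) < e"
        using U by auto
      with l1_dist_triangle[OF assms, of x y] l1_dist_triangle[OF assms, of y x]
      show "dist (l1_dist \<mu> f y) (l1_dist \<mu> f x) < e"
        by (auto simp: dist_real_def)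
    qed
  qed
  then show ?thesis by (simp add: continuous_on_eq_continuous_at)
qed

end

section \<open>Independence of the mean from the realization\<close>

text \<open>Centralizers are closed in a Hausdorff group. Density of the image is used twice: first
  the points \<open>\<iota> g\<close> become central, then all points do.\<close>

lemma group_compactification_add_commute:
  fixes \<iota> :: "'g::topological_ab_group_add \<Rightarrow> 'x::{topological_group_add, t2_space}"
  assumes "group_compactification \<iota>"
  shows "(x :: 'x) + y = y + x"
proof -
  have cl: "closure (range \<iota>) = UNIV" and hom: "\<iota> (g + h) = \<iota> g + \<iota> h" for g h
    using assms by (auto simp: group_compactification_def)
  have dense: "S = UNIV" if "closed S" "range \<iota> \<subseteq> S" for S
    using closure_minimal[OF that(2,1)] cl by auto
  have closed: "closed {y. x + y = y + x}" for x :: 'x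
    by (intro closed_Collect_eq continuous_intros)
  have "{y. \<iota> g + y = y + \<iota> g} = UNIV" for g
    by (intro dense closed) (auto simp: add.commute simp flip: hom)
  then have 1: "\<iota> g + y = y + \<iota> g" for g y
    by blast
  have "{y. x + y = y + x} = UNIV"
    by (intro dense closed) (auto simp: 1)
  then show ?thesis by blast
qed

text \<open>Partition the compact group into small Borel cells, each close to some \<open>\<iota> (g i)\<close>, and take
  the measures of the cells as weights. By invariance the resulting sums are dominated by the
  integral, uniformly in \<open>h\<close>.\<close>

lemma convex_translates_le_integral:
  fixes \<iota> :: "'g::topological_ab_group_add \<Rightarrow> 'x::{topological_group_add, t2_space}"
    and f :: "'x \<Rightarrow> real"
  assumes \<iota>: "group_compactification \<iota>" and haar: "normalized_haar_measure \<mu>"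
    and f: "bounded (range f)" "AE x in \<mu>. isCont f x" and "e > 0"
  obtains n :: nat and w g where "\<And>i. 0 \<le> w i" "(\<Sum>i=0..<n. w i) = 1"
    "\<And>h. (\<Sum>i=0..<n. w i * f (\<iota> (h + g i))) \<le> (\<integral>x. f x \<partial>completion \<mu>) + e"
proof -
  interpret haar_measure \<mu> by unfold_locales fact
  have cpt: "compact (UNIV :: 'x set)" and cl: "closure (range \<iota>) = UNIV"
    and hom: "\<iota> (g + h) = \<iota> g + \<iota> h" for g h
    using \<iota> by (auto simp: group_compactification_def)
  obtain U r where U: "open U" "0 \<in> U" "integrable (completion \<mu>) r"
    "(\<integral>y. r y \<partial>completion \<mu>) < e" "\<And>u y. u \<in> U \<Longrightarrow> norm (f (u + y) - f y) \<le> r y"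
    using integrable_oscillation_bound[OF f \<open>e > 0\<close>] by blast
  \<comment> \<open>\<open>W g\<close> consists of the points that a left translation from
    \<open>U\<close> carries to \<open>\<iota> g\<close>. By density of the image these open sets
    cover the group.\<close>
  define W where "W g = (\<lambda>y. \<iota> g - y) -` U" for g
  have W: "open (W g)" for g
    unfolding W_def by (intro open_vimage continuous_intros U)
  have cover: "UNIV \<subseteq> (\<Union>g. W g)"
  proof
    fix y
    have "open ((\<lambda>z. z - y) -` U)"
      by (intro open_vimage continuous_intros U)
    moreover have "y \<in> (\<lambda>z. z - y) -` U" using U by simp
    ultimately show "y \<in> (\<Union>g. W g)"
      using cl closure_iff_nhds_not_empty[of y "range \<iota>"] by (fastforce simp: W_def)
  qed
  obtain C where C: "finite C" "UNIV \<subseteq> (\<Union>g\<in>C. W g)"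
    by (rule compactE_image[OF cpt W cover])
  obtain g where g: "bij_betw g {0..<card C} C"
    using ex_bij_betw_nat_finite[OF C(1)] by blast
  define n where "n = card C"
  \<comment> \<open>From \<open>n\<close> on the values of \<open>g\<close> are arbitrary; only the
    cells with index below \<open>n\<close> enter, and they already cover everything.\<close>
  define P where "P = disjointed (W \<circ> g)"
  have "range (W \<circ> g) \<subseteq> sets borel" using W by auto
  then have P: "P i \<in> sets borel" for i
    unfolding P_def using sets.range_disjointed_sets by blast
  have PU: "(\<Union>i\<in>{0..<n}. P i) = UNIV"
  proof -
    have "(\<Union>i\<in>{0..<n}. P i) = (\<Union>g\<in>g ` {0..<n}. W g)"
      by (simp add: P_def finite_UN_disjointed_eq)
    then show ?thesis using C(2) bij_betw_imp_surj_on[OF g] by (auto simp: n_def)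
  qed
  have cell: "\<exists>i<n. y \<in> P i" for y
  proof -
    have "y \<in> (\<Union>i\<in>{0..<n}. P i)" unfolding PU by simp
    then show ?thesis by auto
  qed
  have disj: "disjoint_family P"
    unfolding P_def by (rule disjoint_family_disjointed)
  have PW: "\<iota> (g i) - y \<in> U" if "y \<in> P i" for i y
    using that disjointed_subset[of "W \<circ> g" i] by (auto simp: P_def W_def)
  have step: "(\<Sum>i=0..<n. a i * indicator (P i) y) = a i" if "y \<in> P i" "i < n"
    for a :: "nat \<Rightarrow> real" and y i
    using that disj by (intro sum_indicator_disjoint_family) (auto simp: disjoint_family_on_def)
  define w where "w i = measure (completion \<mu>) (P i)" for i
  have int: "(\<integral>y. (\<Sum>i=0..<n. a i * indicator (P i) y) \<partial>completion \<mu>) = (\<Sum>i=0..<n. a i * w i)"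
    "integrable (completion \<mu>) (\<lambda>y. \<Sum>i=0..<n. a i * indicator (P i) y)"
    for a :: "nat \<Rightarrow> real"
  proof -
    have "integrable (completion \<mu>) (\<lambda>y. a i * indicator (P i) y)" for i
      using P[of i] completion.emeasure_finite[of "P i"]
      by (intro integrable_mult_right integrable_real_indicator) (auto simp: top.not_eq_extremum)
    moreover have "(\<integral>y. a i * indicator (P i) y \<partial>completion \<mu>) = a i * w i" for i
      by (simp add: w_def)
    ultimately show
      "(\<integral>y. (\<Sum>i=0..<n. a i * indicator (P i) y) \<partial>completion \<mu>) = (\<Sum>i=0..<n. a i * w i)"
      "integrable (completion \<mu>) (\<lambda>y. \<Sum>i=0..<n. a i * indicator (P i) y)"
      by (simp_all only: Bochner_Integration.integral_sum Bochner_Integration.integrable_sum)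
  qed
  show thesis
  proof (rule that[of w n g])
    show "0 \<le> w i" for i by (simp add: w_def)
    have one: "(\<Sum>i=0..<n. 1 * indicator (P i) y) = (1::real)" for y
    proof -
      obtain i where "y \<in> P i" "i < n" using cell[of y] by blast
      then show ?thesis by (rule step)
    qed
    show "(\<Sum>i=0..<n. w i) = 1"
      using int(1)[of "\<lambda>_. 1"] unfolding one by simp
    fix h
    have fint: "integrable (completion \<mu>) f"
      using f by (rule AE_isCont_integrable)
    have shifted: "integrable (completion \<mu>) (\<lambda>y. f (\<iota> h + y))" "integrable (completion \<mu>) (\<lambda>y. r (\<iota> h + y))"
      using integrable_completion_add[OF fint] integrable_completion_add[OF U(3)] by auto
    \<comment> \<open>The weighted sum is the integral of a step function, which is compared
      pointwise with the translate of \<open>f\<close> by \<open>\<iota> h\<close>.\<close>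
    have "(\<integral>y. (\<Sum>i=0..<n. f (\<iota> (h + g i)) * indicator (P i) y) \<partial>completion \<mu>) \<le>
        (\<integral>y. f (\<iota> h + y) + r (\<iota> h + y) \<partial>completion \<mu>)"
    proof (rule integral_mono)
      fix y
      obtain i where i: "y \<in> P i" "i < n" using cell[of y] by blast
      \<comment> \<open>The element \<open>\<iota> (g i) - y\<close> of \<open>U\<close> carries
        \<open>\<iota> h + y\<close> to \<open>\<iota> (h + g i)\<close>; commutativity of the
        compact group moves \<open>\<iota> h\<close> past \<open>y\<close>.\<close>
      have "(\<iota> (g i) - y) + (\<iota> h + y) = \<iota> (g i) - y + (y + \<iota> h)"
        by (simp only: group_compactification_add_commute[OF \<iota>, of "\<iota> h" y])
      also have "\<dots> = \<iota> (h + g i)"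
        by (simp add: add.commute[of h] hom flip: add.assoc)
      finally have "norm (f (\<iota> (h + g i)) - f (\<iota> h + y)) \<le> r (\<iota> h + y)"
        using U(5)[OF PW[OF i(1)], of "\<iota> h + y"] by simp
      then have "f (\<iota> (h + g i)) \<le> f (\<iota> h + y) + r (\<iota> h + y)"
        by (simp add: abs_le_iff)
      then show "(\<Sum>i=0..<n. f (\<iota> (h + g i)) * indicator (P i) y) \<le> f (\<iota> h + y) + r (\<iota> h + y)"
        using step[OF i, of "\<lambda>i. f (\<iota> (h + g i))"] by simp
    qed (intro int Bochner_Integration.integrable_add shifted)+
    also have "\<dots> = (\<integral>y. f y \<partial>completion \<mu>) + (\<integral>y. r y \<partial>completion \<mu>)"
      using shifted by (simp add: integral_completion_add[OF fint] integral_completion_add[OF U(3)])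
    finally show "(\<Sum>i=0..<n. w i * f (\<iota> (h + g i))) \<le> (\<integral>x. f x \<partial>completion \<mu>) + e"
      using U(4) unfolding int by (simp add: mult.commute)
  qed
qed

text \<open>Averaging over both families of translates bounds the same double sum from above and from
  below, as \<open>G\<close> is commutative.\<close>

lemma integral_le_of_common_restriction:
  fixes \<iota>1 :: "'g::topological_ab_group_add \<Rightarrow> 'x::{topological_group_add, t2_space}"
    and \<iota>2 :: "'g \<Rightarrow> 'y::{topological_group_add, t2_space}"
    and f1 :: "'x \<Rightarrow> real" and f2 :: "'y \<Rightarrow> real"
  assumes 1: "group_compactification \<iota>1" "normalized_haar_measure \<mu>1"
      "bounded (range f1)" "AE x in \<mu>1. isCont f1 x"
    and 2: "group_compactification \<iota>2" "normalized_haar_measure \<mu>2"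
      "bounded (range f2)" "AE x in \<mu>2. isCont f2 x"
    and eq: "\<And>g. f1 (\<iota>1 g) = f2 (\<iota>2 g)"
  shows "(\<integral>x. f2 x \<partial>completion \<mu>2) \<le> (\<integral>x. f1 x \<partial>completion \<mu>1)"
proof (rule field_le_epsilon)
  fix e :: real assume "e > 0"
  then have e: "e / 2 > 0" by simp
  obtain n :: nat and v a where v: "\<And>i. 0 \<le> v i" "(\<Sum>i=0..<n. v i) = 1"
    "\<And>h. (\<Sum>i=0..<n. v i * f1 (\<iota>1 (h + a i))) \<le> (\<integral>x. f1 x \<partial>completion \<mu>1) + e / 2"
    by (rule convex_translates_le_integral[OF 1 e]) (rule that)
  \<comment> \<open>The available estimate is one-sided; for \<open>- f2\<close> it bounds averages
    of \<open>f2\<close> from below.\<close>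
  have "bounded (range (\<lambda>x. - f2 x))" "AE x in \<mu>2. isCont (\<lambda>x. - f2 x) x"
    using 2 by (auto simp: bounded_iff elim!: eventually_mono)
  note 3 = this
  obtain m :: nat and w b where w: "\<And>i. 0 \<le> w i" "(\<Sum>i=0..<m. w i) = 1"
    "\<And>h. (\<Sum>i=0..<m. w i * - f2 (\<iota>2 (h + b i))) \<le> (\<integral>x. - f2 x \<partial>completion \<mu>2) + e / 2"
    by (rule convex_translates_le_integral[OF 2(1,2) 3 e]) (rule that)
  \<comment> \<open>The inner sum is estimated with \<open>h = b j\<close> and, after exchanging the
    sums, with \<open>h = a i\<close>; \<open>eq\<close> lets \<open>s\<close> be read on either
    compactification.\<close>
  define s where "s = (\<Sum>j=0..<m. w j * (\<Sum>i=0..<n. v i * f1 (\<iota>1 (b j + a i))))"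
  have "s \<le> (\<Sum>j=0..<m. w j * ((\<integral>x. f1 x \<partial>completion \<mu>1) + e / 2))"
    unfolding s_def by (intro sum_mono mult_left_mono v w)
  then have s: "s \<le> (\<integral>x. f1 x \<partial>completion \<mu>1) + e / 2"
    by (simp add: w flip: sum_distrib_right)
  have "- s = (\<Sum>i=0..<n. v i * (\<Sum>j=0..<m. w j * - f2 (\<iota>2 (a i + b j))))"
    unfolding s_def eq sum_distrib_left sum_negf[symmetric]
    by (subst sum.swap) (simp add: mult_ac add.commute)
  also have "\<dots> \<le> (\<Sum>i=0..<n. v i * ((\<integral>x. - f2 x \<partial>completion \<mu>2) + e / 2))"
    by (intro sum_mono mult_left_mono v w)
  also have "\<dots> = - (\<integral>x. f2 x \<partial>completion \<mu>2) + e / 2"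
    by (simp add: v flip: sum_distrib_right)
  finally show "(\<integral>x. f2 x \<partial>completion \<mu>2) \<le> (\<integral>x. f1 x \<partial>completion \<mu>1) + e"
    using s by simp
qed

text \<open>The inequality for real functions is applied to real and imaginary parts, with the two
  compactifications in both orders.\<close>

lemma realizations_integral_eq:
  fixes \<iota>1 :: "'g::topological_ab_group_add \<Rightarrow> 'x::{topological_group_add, t2_space}"
    and \<iota>2 :: "'g \<Rightarrow> 'y::{topological_group_add, t2_space}"
  assumes 1: "group_compactification \<iota>1" "normalized_haar_measure \<mu>1" "realizes \<mu>1 \<iota>1 f1 \<phi>"
    and 2: "group_compactification \<iota>2" "normalized_haar_measure \<mu>2" "realizes \<mu>2 \<iota>2 f2 \<phi>"
  shows "(\<integral>x. f1 x \<partial>completion \<mu>1) = (\<integral>x. f2 x \<partial>completion \<mu>2)"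
proof -
  interpret m1: haar_measure \<mu>1 by unfold_locales fact
  interpret m2: haar_measure \<mu>2 by unfold_locales fact
  have r: "riemann_integrable \<mu>1 f1" "riemann_integrable \<mu>2 f2"
    and eq: "f1 (\<iota>1 g) = f2 (\<iota>2 g)" for g
    using 1(3) 2(3) by (auto simp: realizes_def fun_eq_iff)
  have i: "integrable (completion \<mu>1) f1" "integrable (completion \<mu>2) f2"
    using r by (auto intro: m1.riemann_integrable_integrable m2.riemann_integrable_integrable)
  have c1: "bounded (range (\<lambda>x. Re (f1 x)))" "AE x in \<mu>1. isCont (\<lambda>x. Re (f1 x)) x"
      "bounded (range (\<lambda>x. Im (f1 x)))" "AE x in \<mu>1. isCont (\<lambda>x. Im (f1 x)) x"
    using r(1) unfolding m1.riemann_integrable_iff bounded_iff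
    by (auto elim!: eventually_mono intro: abs_Re_le_cmod[THEN order_trans]
        abs_Im_le_cmod[THEN order_trans] continuous_intros)
  have c2: "bounded (range (\<lambda>x. Re (f2 x)))" "AE x in \<mu>2. isCont (\<lambda>x. Re (f2 x)) x"
      "bounded (range (\<lambda>x. Im (f2 x)))" "AE x in \<mu>2. isCont (\<lambda>x. Im (f2 x)) x"
    using r(2) unfolding m2.riemann_integrable_iff bounded_iff
    by (auto elim!: eventually_mono intro: abs_Re_le_cmod[THEN order_trans]
        abs_Im_le_cmod[THEN order_trans] continuous_intros)
  have "(\<integral>x. Re (f1 x) \<partial>completion \<mu>1) = (\<integral>x. Re (f2 x) \<partial>completion \<mu>2)"
    using integral_le_of_common_restriction[OF 1(1,2) c1(1,2) 2(1,2) c2(1,2)]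
      integral_le_of_common_restriction[OF 2(1,2) c2(1,2) 1(1,2) c1(1,2)]
    by (simp add: eq)
  moreover have "(\<integral>x. Im (f1 x) \<partial>completion \<mu>1) = (\<integral>x. Im (f2 x) \<partial>completion \<mu>2)"
    using integral_le_of_common_restriction[OF 1(1,2) c1(3,4) 2(1,2) c2(3,4)]
      integral_le_of_common_restriction[OF 2(1,2) c2(3,4) 1(1,2) c1(3,4)]
    by (simp add: eq)
  ultimately show ?thesis
    unfolding complex_eq_iff using i by simp
qed

section \<open>Hartman mean and distance computed on an arbitrary compactification\<close>

text \<open>Every Bohr realization has the same integral as \<open>f\<close>. The realization
  \<open>\<phi>\<^sub>b\<close> makes the description unique: if there were none, every
  \<open>c\<close> would satisfy it.\<close>

lemma hartman_mean_eq_integral: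
  fixes \<iota>\<^sub>b :: "'g::topological_ab_group_add \<Rightarrow> 'b::{topological_group_add, t2_space}"
    and \<iota> :: "'g \<Rightarrow> 'x::{topological_group_add, t2_space}"
  assumes "group_compactification \<iota>\<^sub>b" "normalized_haar_measure \<mu>\<^sub>b" "realizes \<mu>\<^sub>b \<iota>\<^sub>b \<phi>\<^sub>b \<phi>"
    and "group_compactification \<iota>" "normalized_haar_measure \<mu>" "realizes \<mu> \<iota> f \<phi>"
  shows "hartman_mean \<mu>\<^sub>b \<iota>\<^sub>b \<phi> = (\<integral>x. f x \<partial>completion \<mu>)"
proof -
  have eq: "(\<integral>x. h x \<partial>completion \<mu>\<^sub>b) = (\<integral>x. f x \<partial>completion \<mu>)" if "realizes \<mu>\<^sub>b \<iota>\<^sub>b h \<phi>" for h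
    using assms(1,2) that assms(4-6) by (rule realizations_integral_eq)
  show ?thesis
    unfolding hartman_mean_def
  proof (rule the_equality)
    show "\<forall>h. realizes \<mu>\<^sub>b \<iota>\<^sub>b h \<phi> \<longrightarrow> (\<integral>x. h x \<partial>completion \<mu>\<^sub>b) = (\<integral>x. f x \<partial>completion \<mu>)"
      by (simp add: eq)
    fix c assume "\<forall>h. realizes \<mu>\<^sub>b \<iota>\<^sub>b h \<phi> \<longrightarrow> (\<integral>x. h x \<partial>completion \<mu>\<^sub>b) = c"
    then have "(\<integral>x. \<phi>\<^sub>b x \<partial>completion \<mu>\<^sub>b) = c" using assms(3) by simp
    with eq[OF assms(3)] show "c = (\<integral>x. f x \<partial>completion \<mu>)" by simp
  qed
qed

text \<open>The homomorphism intertwines translation by \<open>g\<close> with translation by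
  \<open>\<iota> g\<close>. This is applied both on the Bohr compactification and on
  \<open>X\<close>.\<close>

lemma realizes_cmod_diff_translate:
  fixes \<iota> :: "'g::topological_ab_group_add \<Rightarrow> 'x::{topological_group_add, t2_space}"
  assumes "group_compactification \<iota>" "normalized_haar_measure \<mu>" "realizes \<mu> \<iota> f \<phi>"
  shows "realizes \<mu> \<iota> (\<lambda>x. complex_of_real (cmod (f x - translate (\<iota> g) f x)))
    (\<lambda>h. complex_of_real (cmod (\<phi> h - translate g \<phi> h)))"
proof -
  interpret haar_measure \<mu> by unfold_locales fact
  from assms(3) have f: "riemann_integrable \<mu> f" "\<phi> = f \<circ> \<iota>" by (auto simp: realizes_def)
  have "\<iota> (g + h) = \<iota> g + \<iota> h" for h
    using assms(1) by (simp add: group_compactification_def)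
  then show ?thesis
    using riemann_integrable_cmod_diff[OF f(1) riemann_integrable_translate[OF f(1)]]
    by (auto simp: realizes_def f(2) translate_def)
qed

lemma hartman_dist_eq_l1_dist:
  fixes \<iota>\<^sub>b :: "'g::topological_ab_group_add \<Rightarrow> 'b::{topological_group_add, t2_space}"
    and \<iota> :: "'g \<Rightarrow> 'x::{topological_group_add, t2_space}"
  assumes "group_compactification \<iota>\<^sub>b" "normalized_haar_measure \<mu>\<^sub>b" "realizes \<mu>\<^sub>b \<iota>\<^sub>b \<phi>\<^sub>b \<phi>"
    and "group_compactification \<iota>" "normalized_haar_measure \<mu>" "realizes \<mu> \<iota> f \<phi>"
  shows "hartman_dist \<mu>\<^sub>b \<iota>\<^sub>b \<phi> g = l1_dist \<mu> f (\<iota> g)"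
  unfolding hartman_dist_def
  using hartman_mean_eq_integral[OF assms(1,2) realizes_cmod_diff_translate[OF assms(1-3)]
      assms(4,5) realizes_cmod_diff_translate[OF assms(4-6)]]
  by (simp add: l1_dist_def)

section \<open>Comparison of the two filters\<close>

theorem theorem1:
  fixes \<iota>\<^sub>b :: "'g::{topological_ab_group_add, t2_space} \<Rightarrow> 'b::{topological_group_add, t2_space}"
    and \<mu>\<^sub>b :: "'b measure"
    and \<iota>\<^sub>X :: "'g \<Rightarrow> 'x::{topological_group_add, t2_space}"
    and \<mu>\<^sub>X :: "'x measure"
    and \<phi> :: "'g \<Rightarrow> complex"
    and \<phi>s :: "'x \<Rightarrow> complex"
  assumes "locally_compact_space (euclidean :: 'g topology)"
    and "bohr_compactification \<iota>\<^sub>b" and "normalized_haar_measure \<mu>\<^sub>b"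
    and "group_compactification \<iota>\<^sub>X" and "normalized_haar_measure \<mu>\<^sub>X"
    and "\<phi> \<in> hartman_measurable \<mu>\<^sub>b \<iota>\<^sub>b"
    and "realizes \<mu>\<^sub>X \<iota>\<^sub>X \<phi>s \<phi>"
  shows "hartman_filter \<mu>\<^sub>b \<iota>\<^sub>b \<phi> \<subseteq> compactification_filter \<iota>\<^sub>X \<and>
    (aperiodic \<mu>\<^sub>X \<phi>s \<longrightarrow> hartman_filter \<mu>\<^sub>b \<iota>\<^sub>b \<phi> = compactification_filter \<iota>\<^sub>X)"
proof -
  interpret haar_measure \<mu>\<^sub>X by unfold_locales fact
  obtain \<phi>\<^sub>b where b: "group_compactification \<iota>\<^sub>b" "realizes \<mu>\<^sub>b \<iota>\<^sub>b \<phi>\<^sub>b \<phi>"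
    using assms by (auto simp: bohr_compactification_def hartman_measurable_def)
  \<comment> \<open>The generators of the Hartman filter are thus preimages of sublevel sets of a
    continuous function on \<open>X\<close>.\<close>
  have d: "hartman_nbhd \<mu>\<^sub>b \<iota>\<^sub>b \<phi> e = \<iota>\<^sub>X -` {x. l1_dist \<mu>\<^sub>X \<phi>s x < e}" for e
    using hartman_dist_eq_l1_dist[OF b(1) assms(3) b(2) assms(4,5,7)]
    by (auto simp: hartman_nbhd_def)
  have R: "riemann_integrable \<mu>\<^sub>X \<phi>s" using assms by (simp add: realizes_def)
  have cont: "continuous_on UNIV (l1_dist \<mu>\<^sub>X \<phi>s)"
    using R by (rule continuous_on_l1_dist)
  have 1: "hartman_filter \<mu>\<^sub>b \<iota>\<^sub>b \<phi> \<subseteq> compactification_filter \<iota>\<^sub>X"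
  proof
    fix A assume "A \<in> hartman_filter \<mu>\<^sub>b \<iota>\<^sub>b \<phi>"
    then obtain e where e: "e > 0" "\<iota>\<^sub>X -` {x. l1_dist \<mu>\<^sub>X \<phi>s x < e} \<subseteq> A"
      by (auto simp: hartman_filter_def d)
    have "open {x. l1_dist \<mu>\<^sub>X \<phi>s x < e}"
      by (intro open_Collect_less cont continuous_on_const)
    \<comment> \<open>Unfolding shows that \<open>l1_dist\<close> vanishes at 0, so the open
      sublevel set contains 0.\<close>
    with e show "A \<in> compactification_filter \<iota>\<^sub>X"
      by (auto simp: compactification_filter_def l1_dist_def translate_def
          intro!: exI[of _ "{x. l1_dist \<mu>\<^sub>X \<phi>s x < e}"])
  qed
  have 2: "compactification_filter \<iota>\<^sub>X \<subseteq> hartman_filter \<mu>\<^sub>b \<iota>\<^sub>b \<phi>" if ap: "aperiodic \<mu>\<^sub>X \<phi>s"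
  proof
    fix A assume "A \<in> compactification_filter \<iota>\<^sub>X"
    then obtain U where U: "open U" "0 \<in> U" "\<iota>\<^sub>X -` U \<subseteq> A"
      by (auto simp: compactification_filter_def)
    have "\<exists>e>0. {x. l1_dist \<mu>\<^sub>X \<phi>s x < e} \<subseteq> U"
    \<comment> \<open>A minimum is taken over \<open>- U\<close>, which has to be nonempty; for
      \<open>U = UNIV\<close> any positive \<open>e\<close> will do.\<close>
    proof (cases "U = UNIV")
      case True
      then show ?thesis by (auto intro: exI[of _ 1])
    next
      case False
      have "compact (UNIV :: 'x set)" using assms(4) by (simp add: group_compactification_def)
      then have "compact (- U)"
        using U(1) compact_Int_closed[of UNIV "- U"] by auto
      moreover have "- U \<noteq> {}" using False by blast
      ultimately have "\<exists>x\<in>- U. \<forall>y\<in>- U. l1_dist \<mu>\<^sub>X \<phi>s x \<le> l1_dist \<mu>\<^sub>X \<phi>s y"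
        by (rule continuous_attains_inf) (rule continuous_on_subset[OF cont subset_UNIV])
      then obtain x where x: "x \<in> - U" "\<forall>y\<in>- U. l1_dist \<mu>\<^sub>X \<phi>s x \<le> l1_dist \<mu>\<^sub>X \<phi>s y"
        by blast
      have "x \<notin> {0}" using x(1) U(2) by blast
      then have "l1_dist \<mu>\<^sub>X \<phi>s x \<noteq> 0"
        unfolding ap[unfolded aperiodic_def, symmetric] by (rule contrapos_nn) (rule CollectI)
      moreover have "l1_dist \<mu>\<^sub>X \<phi>s x \<ge> 0" by (simp add: l1_dist_def)
      \<comment> \<open>The positive minimum over \<open>- U\<close> is the required
        \<open>e\<close>: a strictly smaller value is attained only inside \<open>U\<close>.\<close>
      ultimately show ?thesis
        using x(2) by (intro exI[of _ "l1_dist \<mu>\<^sub>X \<phi>s x"] conjI subsetI) (auto simp: not_less[symmetric])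
    qed
    with U(3) show "A \<in> hartman_filter \<mu>\<^sub>b \<iota>\<^sub>b \<phi>"
      unfolding hartman_filter_def d by blast
  qed
  from 1 2 show ?thesis by blast
qed

end
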